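(* Let $\rho:(u_1,u_2)\to\mathbb{R}^{>0}$ be a conformal factor of class $C^3$ and let $c>0$ be a constant such that $c\,\rho(u)>|\rho'(u)|$ for all $u_1<u<u_2$. Then there is an intrinsic surface of revolution defined on the domain $(u_1,u_2)\times\mathbb{R}$ with first fundamental form $I_\rho$ and twist $\alpha(v)\equiv0$. Moreover, this surface can be realized as an actual surface of revolution in $\mathbb{R}^3$ of the form $$f(u,v)=\bigl(g(u)\cos(cv),\,g(u)\sin(cv),\,h(u)\bigr)$$ with suitable functions $g,h:(u_1,u_2)\to\mathbb{R}$.
   Context: An intrinsic surface of revolution is an immersed surface $f:(u_1,u_2)\times\mathbb{R}\to\mathbb{R}^3$ with coordinates $(u,v)$ whose first fundamental form is $I_\rho=\rho(u)^2(du^2+dv^2)$ for a positive function $\rho$ of $u$ alone. It has twist $\alpha\equiv0$ if the matrix of its shape operator with respect to the coordinate basis $(\partial/\partial u,\partial/\partial v)$ is $\operatorname{diag}(\lambda_1(u),\lambda_2(u))$ for functions $\lambda_1,\lambda_2$ of $u$ alone. *)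

theory Defs
  imports "HOL-Analysis.Analysis"
begin

text \<open>Functions of class \<open>C\<^sup>k\<close> on an open set of a normed space, by iterated directional
  derivatives; not meaningful for sets that are not open.\<close>

fun C_k_on :: "nat \<Rightarrow> ('a::real_normed_vector \<Rightarrow> 'b::real_normed_vector) \<Rightarrow> 'a set \<Rightarrow> bool" where
  "C_k_on 0 f S \<longleftrightarrow> continuous_on S f"
| "C_k_on (Suc k) f S \<longleftrightarrow>
     (\<forall>x\<in>S. f differentiable at x) \<and>
     (\<forall>v. C_k_on k (\<lambda>x. frechet_derivative f (at x) v) S)"

text \<open>Surfaces are parametrized over open sets of the \<open>(u, v)\<close>-plane. Tangent vectors are represented
  by their components in the coordinate basis, so \<open>(1, 0)\<close> and \<open>(0, 1)\<close> are the coordinate vectors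
  for \<open>u\<close> and \<open>v\<close>. Surfaces are of class \<open>C\<^sup>3\<close>, matching conformal factors of class \<open>C\<^sup>3\<close>.\<close>

definition immersed_surface :: "(real \<times> real) set \<Rightarrow> (real \<times> real \<Rightarrow> real^3) \<Rightarrow> bool" where
  "immersed_surface U f \<longleftrightarrow> C_k_on 3 f U \<and> (\<forall>p\<in>U. inj (frechet_derivative f (at p)))"

definition first_fundamental_form ::
    "(real \<times> real \<Rightarrow> real^3) \<Rightarrow> real \<times> real \<Rightarrow> real \<times> real \<Rightarrow> real \<times> real \<Rightarrow> real" where
  "first_fundamental_form f p x y = frechet_derivative f (at p) x \<bullet> frechet_derivative f (at p) y"

definition I_form ::
    "(real \<Rightarrow> real) \<Rightarrow> real \<times> real \<Rightarrow> real \<times> real \<Rightarrow> real \<times> real \<Rightarrow> real" where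
  "I_form \<rho> p x y = (\<rho> (fst p))\<^sup>2 * (fst x * fst y + snd x * snd y)"

definition unit_normal :: "(real \<times> real \<Rightarrow> real^3) \<Rightarrow> real \<times> real \<Rightarrow> real^3" where
  "unit_normal f p =
     sgn (cross3 (frechet_derivative f (at p) (1, 0)) (frechet_derivative f (at p) (0, 1)))"

text \<open>The endomorphism \<open>A\<close> of the tangent space with \<open>df \<circ> A = - dN\<close>, where \<open>N\<close> is the unit normal.
  It exists and is unique for every immersed surface as above.\<close>

definition shape_operator ::
    "(real \<times> real \<Rightarrow> real^3) \<Rightarrow> real \<times> real \<Rightarrow> real \<times> real \<Rightarrow> real \<times> real" where
  "shape_operator f p x =
     (THE y. frechet_derivative f (at p) y = - frechet_derivative (unit_normal f) (at p) x)"

text \<open>The domain \<open>(u\<^sub>1, u\<^sub>2) \<times> \<real>\<close>; the endpoints may be infinite.\<close>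

definition strip :: "ereal \<Rightarrow> ereal \<Rightarrow> (real \<times> real) set" where
  "strip u1 u2 = einterval u1 u2 \<times> UNIV"

definition intrinsic_surface_of_revolution ::
    "ereal \<Rightarrow> ereal \<Rightarrow> (real \<Rightarrow> real) \<Rightarrow> (real \<times> real \<Rightarrow> real^3) \<Rightarrow> bool" where
  "intrinsic_surface_of_revolution u1 u2 \<rho> f \<longleftrightarrow>
     (\<forall>u\<in>einterval u1 u2. \<rho> u > 0) \<and>
     immersed_surface (strip u1 u2) f \<and>
     (\<forall>p\<in>strip u1 u2. \<forall>x y. first_fundamental_form f p x y = I_form \<rho> p x y)"

text \<open>The columns of the matrix of the shape operator are its values on the coordinate vectors.\<close>

definition twist_zero :: "ereal \<Rightarrow> ereal \<Rightarrow> (real \<times> real \<Rightarrow> real^3) \<Rightarrow> bool" where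
  "twist_zero u1 u2 f \<longleftrightarrow>
     (\<exists>l1 l2 :: real \<Rightarrow> real. \<forall>u\<in>einterval u1 u2. \<forall>v.
        shape_operator f (u, v) (1, 0) = (l1 u, 0) \<and>
        shape_operator f (u, v) (0, 1) = (0, l2 u))"

end

theory Submission
  imports Defs
begin

text \<open>
  For a profile curve \<open>(g, h)\<close> rotated through the angle \<open>c v\<close>, the coordinate vectors
  \<open>f\<^sub>u\<close> and \<open>f\<^sub>v\<close> are orthogonal, with squared lengths \<open>g'\<^sup>2 + h'\<^sup>2\<close> and \<open>c\<^sup>2 g\<^sup>2\<close>. Both squares
  equal \<open>\<rho>\<^sup>2\<close> if \<open>g = \<rho> / c\<close> and \<open>h'\<^sup>2 = \<rho>\<^sup>2 - (\<rho>' / c)\<^sup>2\<close>. The hypothesis \<open>c \<rho> > \<bar>\<rho>'\<bar>\<close> says that the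
  right-hand side of the last equation is positive, so its square root \<open>h'\<close> is as smooth as \<open>\<rho>'\<close>,
  namely \<open>C\<^sup>2\<close>, and an antiderivative \<open>h\<close> of it is \<open>C\<^sup>3\<close>.

  The unit normal is itself generated by rotating a curve, namely \<open>(-h', g') / \<rho>\<close>, the unit normal
  of the profile (lemma \<open>unit_normal_f\<close>). A unit vector is orthogonal to its derivative, so the
  \<open>u\<close>-derivative of the normal stays in the plane of the profile and is parallel to \<open>f\<^sub>u\<close>. Its
  \<open>v\<close>-derivative points along the circle of rotation and is parallel to \<open>f\<^sub>v\<close>. Both factors of
  proportionality are independent of \<open>v\<close> by rotational symmetry, so the twist vanishes (lemma
  \<open>shape_operator_f\<close>).

  That \<open>f\<close> is \<open>C\<^sup>3\<close> as a map on the strip follows from the closure of the classes \<open>C\<^sup>k\<close> under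
  sums, products and composition.
\<close>

section \<open>Calculus of \<open>C\<^sup>k\<close> functions\<close>

lemma C_k_on_cong:
  assumes "open S" "\<And>x. x \<in> S \<Longrightarrow> f x = g x"
  shows "C_k_on k f S \<longleftrightarrow> C_k_on k g S"
proof -
  have "C_k_on k g S"
    if "C_k_on k f S" "\<And>x. x \<in> S \<Longrightarrow> f x = g x" for f g :: "'a \<Rightarrow> 'b"
    using that
  proof (induction k arbitrary: f g)
    case 0
    then show ?case by (metis C_k_on.simps(1) continuous_on_cong)
  next
    case (Suc k)
    have der: "(g has_derivative frechet_derivative f (at x)) (at x)" if "x \<in> S" for x
    proof (rule has_derivative_transform_within_open[OF _ assms(1) that Suc.prems(2)])
      show "(f has_derivative frechet_derivative f (at x)) (at x)"
        using Suc.prems(1) that frechet_derivative_works by fastforce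
    qed
    have "frechet_derivative f (at x) = frechet_derivative g (at x)" if "x \<in> S" for x
      by (rule frechet_derivative_at[OF der[OF that]])
    then have eq: "frechet_derivative f (at x) v = frechet_derivative g (at x) v" if "x \<in> S" for x v
      using that by simp
    have "C_k_on k (\<lambda>x. frechet_derivative g (at x) v) S" for v
      using Suc.prems(1) by (intro Suc.IH[OF _ eq]) simp
    moreover have "\<forall>x\<in>S. g differentiable at x"
      using der differentiable_def by blast
    ultimately show ?case by simp
  qed
  from this[of f g] this[of g f] assms(2) show ?thesis by auto
qed

text \<open>The definition of \<open>C_k_on\<close> speaks of \<open>frechet_derivative\<close>. This rule accepts a derivative that
  is known only on \<open>S\<close>, in whatever form it was computed; openness of \<open>S\<close> makes the two
  interchangeable.\<close>

lemma C_k_on_SucI: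
  assumes "open S" "\<And>x. x \<in> S \<Longrightarrow> (f has_derivative D x) (at x)" "\<And>v. C_k_on k (\<lambda>x. D x v) S"
  shows "C_k_on (Suc k) f S"
proof -
  have "frechet_derivative f (at x) = D x" if "x \<in> S" for x
    by (rule frechet_derivative_at[OF assms(2)[OF that], symmetric])
  then have "C_k_on k (\<lambda>x. frechet_derivative f (at x) v) S" for v
    using assms(3)[of v]
    by (subst C_k_on_cong[OF \<open>open S\<close>, where g = "\<lambda>x. D x v"]) auto
  moreover have "\<forall>x\<in>S. f differentiable at x"
    using assms(2) differentiable_def by blast
  ultimately show ?thesis by simp
qed

lemma C_k_on_SucD:
  assumes "C_k_on (Suc k) f S"
  shows "C_k_on k f S"
  using assms
proof (induction k arbitrary: f)
  case 0
  then show ?case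
    by (simp add: continuous_at_imp_continuous_on differentiable_imp_continuous_within)
next
  case (Suc k)
  then have "\<forall>x\<in>S. f differentiable at x"
    "\<forall>v. C_k_on (Suc k) (\<lambda>x. frechet_derivative f (at x) v) S"
    unfolding C_k_on.simps(2)[of "Suc k"] by blast+
  then show ?case
    by (subst C_k_on.simps(2)) (blast intro: Suc.IH)
qed

lemma C_k_on_const:
  assumes "open S"
  shows "C_k_on k (\<lambda>x. a) S"
proof (induction k arbitrary: a)
  case (Suc k)
  show ?case
    by (rule C_k_on_SucI[OF assms has_derivative_const Suc])
qed simp

lemma C_k_on_bounded_linear:
  assumes "bounded_linear f" "open S"
  shows "C_k_on k f S"
proof (cases k)
  case 0
  then show ?thesis using assms by (simp add: linear_continuous_on)
next
  case (Suc k')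
  show ?thesis
    unfolding Suc
    by (rule C_k_on_SucI[OF assms(2) bounded_linear_imp_has_derivative[OF assms(1)]
        C_k_on_const[OF assms(2)]])
qed

lemma C_k_on_add:
  assumes "open S" "C_k_on k f S" "C_k_on k g S"
  shows "C_k_on k (\<lambda>x. f x + g x) S"
  using assms(2,3)
proof (induction k arbitrary: f g)
  case 0
  then show ?case by (auto intro: continuous_on_add)
next
  case (Suc k)
  show ?case
  proof (rule C_k_on_SucI[OF \<open>open S\<close>])
    show "((\<lambda>x. f x + g x) has_derivative
        (\<lambda>v. frechet_derivative f (at x) v + frechet_derivative g (at x) v)) (at x)" if "x \<in> S" for x
      using Suc.prems that by (auto intro!: has_derivative_add simp: frechet_derivative_works)
  next
    show "C_k_on k (\<lambda>x. frechet_derivative f (at x) v + frechet_derivative g (at x) v) S" for v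
      by (rule Suc.IH) (use Suc.prems in simp_all)
  qed
qed

lemma C_k_on_scaleR:
  fixes f :: "'a::real_normed_vector \<Rightarrow> real" and g :: "'a \<Rightarrow> 'b::real_normed_vector"
  assumes "open S" "C_k_on k f S" "C_k_on k g S"
  shows "C_k_on k (\<lambda>x. f x *\<^sub>R g x) S"
  using assms(2,3)
proof (induction k arbitrary: f g)
  case 0
  then show ?case by (auto intro: continuous_on_scaleR)
next
  case (Suc k)
  show ?case
  proof (rule C_k_on_SucI[OF \<open>open S\<close>])
    show "((\<lambda>x. f x *\<^sub>R g x) has_derivative
        (\<lambda>v. f x *\<^sub>R frechet_derivative g (at x) v + frechet_derivative f (at x) v *\<^sub>R g x)) (at x)"
      if "x \<in> S" for x
      using Suc.prems that by (auto intro!: has_derivative_scaleR simp: frechet_derivative_works)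
  next
    show "C_k_on k (\<lambda>x. f x *\<^sub>R frechet_derivative g (at x) v
        + frechet_derivative f (at x) v *\<^sub>R g x) S" for v
      using Suc.prems C_k_on_SucD[OF Suc.prems(1)] C_k_on_SucD[OF Suc.prems(2)]
      by (intro C_k_on_add Suc.IH \<open>open S\<close>) simp_all
  qed
qed

lemmas C_k_on_mult = C_k_on_scaleR[where 'b = real, unfolded real_scaleR_def]

lemma frechet_derivative_real:
  fixes f :: "real \<Rightarrow> real"
  assumes "f differentiable at x"
  shows "frechet_derivative f (at x) v = deriv f x * v"
  using assms
  by (metis DERIV_deriv_iff_real_differentiable frechet_derivative_at has_field_derivative_def)

text \<open>On the line every directional derivative is a constant multiple of \<open>deriv f\<close>, so one function
  carries the whole condition.\<close>

lemma C_k_on_Suc_real_iff: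
  fixes f :: "real \<Rightarrow> real"
  assumes "open S"
  shows "C_k_on (Suc k) f S \<longleftrightarrow> (\<forall>x\<in>S. f differentiable at x) \<and> C_k_on k (deriv f) S"
proof (intro iffI conjI; (elim conjE)?)
  assume C: "C_k_on (Suc k) f S"
  then show diff: "\<forall>x\<in>S. f differentiable at x" by simp
  from C have "C_k_on k (\<lambda>x. frechet_derivative f (at x) 1) S" by simp
  then show "C_k_on k (deriv f) S"
    using diff by (subst C_k_on_cong[OF assms, where g = "\<lambda>x. frechet_derivative f (at x) 1"])
      (auto simp: frechet_derivative_real)
next
  assume diff: "\<forall>x\<in>S. f differentiable at x" and C: "C_k_on k (deriv f) S"
  show "C_k_on (Suc k) f S"
  proof (rule C_k_on_SucI[OF assms])
    show "(f has_derivative (\<lambda>v. deriv f x * v)) (at x)" if "x \<in> S" for x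
      using that diff by (metis DERIV_deriv_iff_real_differentiable has_field_derivative_def)
    show "C_k_on k (\<lambda>x. deriv f x * v) S" for v
      by (intro C_k_on_mult C_k_on_const C assms)
  qed
qed

lemma C_k_on_Suc_realI:
  fixes f :: "real \<Rightarrow> real"
  assumes "open S" "\<And>x. x \<in> S \<Longrightarrow> (f has_real_derivative f' x) (at x)" "C_k_on k f' S"
  shows "C_k_on (Suc k) f S"
proof -
  have "C_k_on k (deriv f) S"
    using assms(3) by (subst C_k_on_cong[OF assms(1), where g = f']) (auto intro: DERIV_imp_deriv assms)
  moreover have "\<forall>x\<in>S. f differentiable at x"
    using assms(2) real_differentiable_def by blast
  ultimately show ?thesis
    by (simp only: C_k_on_Suc_real_iff[OF assms(1)] simp_thms)
qed

text \<open>With \<open>\<phi>\<close> defined on the line, the chain rule reads \<open>d(\<phi> \<circ> f) = (\<phi>' \<circ> f) df\<close>: a product in which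
  the induction hypothesis, applied to \<open>\<phi>'\<close> instead of \<open>\<phi>\<close>, handles the first factor.\<close>

lemma C_k_on_compose:
  fixes \<phi> :: "real \<Rightarrow> real" and f :: "'a::real_normed_vector \<Rightarrow> real"
  assumes "open S" "open T" "f ` S \<subseteq> T" "C_k_on k f S" "C_k_on k \<phi> T"
  shows "C_k_on k (\<lambda>x. \<phi> (f x)) S"
  using assms(4,5)
proof (induction k arbitrary: \<phi>)
  case 0
  then show ?case using assms(3) by (auto intro: continuous_on_compose2)
next
  case (Suc k)
  have \<phi>: "\<And>y. y \<in> T \<Longrightarrow> \<phi> differentiable at y" "C_k_on k (deriv \<phi>) T"
    using Suc.prems(2) C_k_on_Suc_real_iff[OF \<open>open T\<close>] by auto
  show ?case
  proof (rule C_k_on_SucI[OF \<open>open S\<close>])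
    show "((\<lambda>x. \<phi> (f x)) has_derivative
        (\<lambda>v. deriv \<phi> (f x) * frechet_derivative f (at x) v)) (at x)" if "x \<in> S" for x
    proof -
      have "(\<phi> has_derivative (*) (deriv \<phi> (f x))) (at (f x))"
        using \<phi>(1)[of "f x"] that assms(3)
        by (metis DERIV_deriv_iff_real_differentiable has_field_derivative_def image_subset_iff)
      moreover have "(f has_derivative frechet_derivative f (at x)) (at x)"
        using Suc.prems(1) that by (auto simp: frechet_derivative_works)
      ultimately show ?thesis
        using has_derivative_compose by blast
    qed
  next
    show "C_k_on k (\<lambda>x. deriv \<phi> (f x) * frechet_derivative f (at x) v) S" for v
      using Suc.prems(1)
      by (intro C_k_on_mult[OF \<open>open S\<close> Suc.IH[OF C_k_on_SucD[OF Suc.prems(1)] \<phi>(2)]]) simp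
  qed
qed

lemma C_k_on_sin_cos:
  shows "C_k_on k sin (UNIV :: real set)" "C_k_on k cos (UNIV :: real set)"
proof (induction k)
  case 0
  {
    case 1 show ?case by (simp add: continuous_on_sin)
  next
    case 2 show ?case by (simp add: continuous_on_cos)
  }
next
  case (Suc k)
  {
    case 1
    show ?case
      by (rule C_k_on_Suc_realI[OF open_UNIV _ Suc(2)]) (auto intro!: derivative_eq_intros)
  next
    case 2
    have "C_k_on k (\<lambda>x. -1 * sin x) (UNIV :: real set)"
      by (intro C_k_on_mult C_k_on_const Suc open_UNIV)
    then show ?case
      by (rule C_k_on_Suc_realI[OF open_UNIV, rotated]) (auto intro!: derivative_eq_intros)
  }
qed

text \<open>Powers with arbitrary real exponents are closed under differentiation up to constants, which
  gives an induction that the square root alone does not admit.\<close>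

lemma C_k_on_powr: "C_k_on k (\<lambda>x::real. x powr a) {0<..}"
proof (induction k arbitrary: a)
  case 0
  show ?case
    by (auto intro!: continuous_on_powr continuous_on_id continuous_on_const)
next
  case (Suc k)
  show ?case
  proof (rule C_k_on_Suc_realI)
    show "C_k_on k (\<lambda>x. a * x powr (a - 1)) {0<..}"
      by (intro C_k_on_mult C_k_on_const Suc open_greaterThan)
  qed (auto intro!: derivative_eq_intros)
qed

lemma C_k_on_sqrt:
  fixes f :: "'a::real_normed_vector \<Rightarrow> real"
  assumes "open S" "C_k_on k f S" "\<And>x. x \<in> S \<Longrightarrow> f x > 0"
  shows "C_k_on k (\<lambda>x. sqrt (f x)) S"
proof -
  have "C_k_on k (\<lambda>x. f x powr (1/2)) S"
    using assms by (intro C_k_on_compose[OF _ _ _ _ C_k_on_powr]) auto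
  then show ?thesis
    using assms by (subst C_k_on_cong[where g = "\<lambda>x. f x powr (1/2)"]) (auto simp: powr_half_sqrt less_imp_le)
qed

section \<open>Maps generated by rotating a profile curve\<close>

text \<open>Surface and unit normal both have this form, so smoothness and the derivative are computed
  once for all \<open>p\<close> and \<open>q\<close>.\<close>

definition revolve :: "real \<Rightarrow> (real \<Rightarrow> real) \<Rightarrow> (real \<Rightarrow> real) \<Rightarrow> real \<times> real \<Rightarrow> real^3" where
  "revolve c p q = (\<lambda>(u, v). vector [p u * cos (c * v), p u * sin (c * v), q u])"

lemma vector_3_eq_axes:
  "(vector [x, y, z] :: real^3) = x *\<^sub>R axis 1 1 + y *\<^sub>R axis 2 1 + z *\<^sub>R axis 3 1"
  by (simp add: vec_eq_iff forall_3 axis_def)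

lemma revolve_eq_axes:
  "revolve c p q = (\<lambda>w. (p (fst w) * cos (c * snd w)) *\<^sub>R axis 1 1
     + (p (fst w) * sin (c * snd w)) *\<^sub>R axis 2 1 + q (fst w) *\<^sub>R axis 3 1)"
  by (auto simp: revolve_def vector_3_eq_axes)

lemma inner_vector_3:
  "(vector [x, y, z] :: real^3) \<bullet> vector [x', y', z'] = x * x' + y * y' + z * z'"
  by (simp add: inner_vec_def sum_3)

lemma C_k_on_revolve:
  assumes "open S" "C_k_on k p S" "C_k_on k q S"
  shows "C_k_on k (revolve c p q) (S \<times> UNIV)"
proof -
  have op: "open (S \<times> (UNIV :: real set))"
    using assms(1) by (simp add: open_Times)
  have "bounded_linear (\<lambda>w :: real \<times> real. c * snd w)"
    by (intro bounded_linear_const_mult bounded_linear_snd)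
  note snd = C_k_on_bounded_linear[OF this op, of k]
  show ?thesis
    unfolding revolve_eq_axes
    by (intro C_k_on_add C_k_on_scaleR C_k_on_mult C_k_on_const op
        C_k_on_compose[OF op \<open>open S\<close> _ C_k_on_bounded_linear[OF bounded_linear_fst op]]
        C_k_on_compose[OF op open_UNIV _ snd] C_k_on_sin_cos assms) auto
qed

lemma has_derivative_revolve:
  assumes "(p has_real_derivative p') (at u)" "(q has_real_derivative q') (at u)"
  shows "(revolve c p q has_derivative (\<lambda>(x, y). vector
     [p' * x * cos (c * v) - c * p u * y * sin (c * v),
      p' * x * sin (c * v) + c * p u * y * cos (c * v), q' * x])) (at (u, v))"
proof -
  have p: "((\<lambda>w. p (fst w)) has_derivative (\<lambda>w. p' * fst w)) (at (u, v))"
    using has_derivative_compose[of fst fst "(u, v)" UNIV p "(*) p'"] assms(1)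
    by (simp add: has_field_derivative_def has_derivative_fst)
  have q: "((\<lambda>w. q (fst w)) has_derivative (\<lambda>w. q' * fst w)) (at (u, v))"
    using has_derivative_compose[of fst fst "(u, v)" UNIV q "(*) q'"] assms(2)
    by (simp add: has_field_derivative_def has_derivative_fst)
  have 1: "((\<lambda>w. p (fst w) * cos (c * snd w)) has_derivative
      (\<lambda>w. p' * fst w * cos (c * v) - c * p u * snd w * sin (c * v))) (at (u, v))"
    by (rule derivative_eq_intros p refl | simp add: fun_eq_iff algebra_simps)+
  have 2: "((\<lambda>w. p (fst w) * sin (c * snd w)) has_derivative
      (\<lambda>w. p' * fst w * sin (c * v) + c * p u * snd w * cos (c * v))) (at (u, v))"
    by (rule derivative_eq_intros p refl | simp add: fun_eq_iff algebra_simps)+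
  show ?thesis
    unfolding revolve_eq_axes vector_3_eq_axes split_beta
    by (intro has_derivative_add has_derivative_scaleR_left 1 2 q)
qed

lemmas frechet_derivative_revolve = frechet_derivative_at[OF has_derivative_revolve, symmetric]

section \<open>Geometry of a conformally parametrized surface of revolution\<close>

text \<open>The equation \<open>\<rho> u = c * g u\<close> normalizes the circles of rotation and \<open>speed\<close> normalizes the
  profile curve; together they make the parametrization conformal with factor \<open>\<rho>\<close>.\<close>

locale conformal_profile =
  fixes S :: "real set" and c :: real and \<rho> g h g' h' :: "real \<Rightarrow> real"
  assumes open_S: "open S"
    and \<rho>_pos: "u \<in> S \<Longrightarrow> \<rho> u > 0"
    and \<rho>_eq: "u \<in> S \<Longrightarrow> \<rho> u = c * g u"
    and deriv_g: "u \<in> S \<Longrightarrow> (g has_real_derivative g' u) (at u)"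
    and deriv_h: "u \<in> S \<Longrightarrow> (h has_real_derivative h' u) (at u)"
    and speed: "u \<in> S \<Longrightarrow> (g' u)\<^sup>2 + (h' u)\<^sup>2 = (\<rho> u)\<^sup>2"
    and diff_g': "u \<in> S \<Longrightarrow> g' differentiable at u"
    and diff_h': "u \<in> S \<Longrightarrow> h' differentiable at u"
begin

abbreviation "f \<equiv> revolve c g h"

text \<open>The velocity \<open>(g', h')\<close> of the profile, turned by a right angle and scaled to length one.\<close>

abbreviation "normal \<equiv> revolve c (\<lambda>u. - (h' u / \<rho> u)) (\<lambda>u. g' u / \<rho> u)"

lemma frechet_derivative_f:
  assumes "u \<in> S"
  shows "frechet_derivative f (at (u, v)) (x, y) = vector
    [g' u * x * cos (c * v) - \<rho> u * y * sin (c * v),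
     g' u * x * sin (c * v) + \<rho> u * y * cos (c * v), h' u * x]"
  using frechet_derivative_revolve[OF deriv_g[OF assms] deriv_h[OF assms]] \<rho>_eq[OF assms] by simp

lemma first_fundamental_form_f:
  assumes "u \<in> S"
  shows "first_fundamental_form f (u, v) x y = I_form \<rho> (u, v) x y"
proof (cases x; cases y)
  fix a b a' b' assume xy: "x = (a, b)" "y = (a', b')"
  let ?C = "cos (c * v)" and ?S = "sin (c * v)"
  have "first_fundamental_form f (u, v) x y
      = (g' u)\<^sup>2 * a * a' * (?S\<^sup>2 + ?C\<^sup>2) + (h' u)\<^sup>2 * a * a' + (\<rho> u)\<^sup>2 * b * b' * (?S\<^sup>2 + ?C\<^sup>2)"
    unfolding first_fundamental_form_def xy frechet_derivative_f[OF assms] inner_vector_3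
    by (simp add: algebra_simps power2_eq_square
        del: sin_cos_squared_add sin_cos_squared_add2 sin_cos_squared_add3)
  also have "\<dots> = ((g' u)\<^sup>2 + (h' u)\<^sup>2) * a * a' + (\<rho> u)\<^sup>2 * b * b'"
    by (simp add: algebra_simps)
  also have "\<dots> = I_form \<rho> (u, v) x y"
    by (simp add: speed[OF assms] I_form_def xy algebra_simps)
  finally show ?thesis .
qed

text \<open>A vector in the kernel would have length zero in the first fundamental form, which is positive
  definite.\<close>

lemma inj_frechet_derivative_f:
  assumes "u \<in> S"
  shows "inj (frechet_derivative f (at (u, v)))"
proof -
  have "linear (frechet_derivative f (at (u, v)))"
    using has_derivative_revolve[OF deriv_g[OF assms] deriv_h[OF assms]]
    by (intro linear_frechet_derivative) (auto simp: differentiable_def)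
  moreover have "x = 0" if "frechet_derivative f (at (u, v)) x = 0" for x
  proof -
    have "(\<rho> u)\<^sup>2 * ((fst x)\<^sup>2 + (snd x)\<^sup>2) = first_fundamental_form f (u, v) x x"
      by (simp add: first_fundamental_form_f[OF assms] I_form_def power2_eq_square)
    also have "\<dots> = 0"
      by (simp add: first_fundamental_form_def that)
    finally show "x = 0"
      using \<rho>_pos[OF assms] by (simp add: sum_power2_eq_zero_iff prod_eq_iff)
  qed
  ultimately show ?thesis by (simp add: linear_injective_0)
qed

lemma unit_normal_f:
  assumes "u \<in> S"
  shows "unit_normal f (u, v) = normal (u, v)"
proof -
  let ?X = "cross3 (frechet_derivative f (at (u, v)) (1, 0)) (frechet_derivative f (at (u, v)) (0, 1))"
  have \<rho>: "\<rho> u > 0" by (rule \<rho>_pos[OF assms])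
  have "?X = \<rho> u *\<^sub>R vector [- (h' u * cos (c * v)), - (h' u * sin (c * v)),
      g' u * ((sin (c * v))\<^sup>2 + (cos (c * v))\<^sup>2)]"
    unfolding frechet_derivative_f[OF assms]
    by (simp add: cross3_def vec_eq_iff forall_3 algebra_simps power2_eq_square
        del: sin_cos_squared_add sin_cos_squared_add2 sin_cos_squared_add3)
  also have "\<dots> = (\<rho> u)\<^sup>2 *\<^sub>R normal (u, v)"
    unfolding sin_cos_squared_add
    using \<rho> by (simp add: revolve_def vec_eq_iff forall_3 power2_eq_square)
  finally have X: "?X = (\<rho> u)\<^sup>2 *\<^sub>R normal (u, v)" .
  have "normal (u, v) \<bullet> normal (u, v)
      = (h' u / \<rho> u)\<^sup>2 * ((sin (c * v))\<^sup>2 + (cos (c * v))\<^sup>2) + (g' u / \<rho> u)\<^sup>2"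
    by (simp add: revolve_def inner_vector_3 algebra_simps power2_eq_square
        del: sin_cos_squared_add sin_cos_squared_add2 sin_cos_squared_add3)
  also have "\<dots> = ((g' u)\<^sup>2 + (h' u)\<^sup>2) / (\<rho> u)\<^sup>2"
    by (simp add: power_divide add_divide_distrib)
  also have "\<dots> = 1"
    using \<rho> by (simp add: speed[OF assms])
  finally have "norm (normal (u, v)) = 1"
    by (simp add: norm_eq_1)
  then show ?thesis
    using \<rho> by (simp add: unit_normal_def X sgn_scaleR sgn_div_norm)
qed

lemma deriv_normal_profile:
  assumes "u \<in> S"
  shows "((\<lambda>u. h' u / \<rho> u) has_real_derivative deriv (\<lambda>u. h' u / \<rho> u) u) (at u)"
    and "((\<lambda>u. g' u / \<rho> u) has_real_derivative deriv (\<lambda>u. g' u / \<rho> u) u) (at u)"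
proof -
  have "((\<lambda>u. c * g u) has_real_derivative c * g' u) (at u)"
    by (intro DERIV_cmult deriv_g assms)
  then have "(\<rho> has_real_derivative c * g' u) (at u)"
    by (rule has_field_derivative_transform_within_open[OF _ open_S assms]) (simp add: \<rho>_eq)
  then have "\<rho> differentiable at u"
    using real_differentiable_def by blast
  then show "((\<lambda>u. h' u / \<rho> u) has_real_derivative deriv (\<lambda>u. h' u / \<rho> u) u) (at u)"
    "((\<lambda>u. g' u / \<rho> u) has_real_derivative deriv (\<lambda>u. g' u / \<rho> u) u) (at u)"
    using diff_g'[OF assms] diff_h'[OF assms] \<rho>_pos[OF assms]
    by (simp_all add: DERIV_deriv_iff_real_differentiable differentiable_divide)
qed

text \<open>The curve \<open>(h', g') / \<rho>\<close> has constant length one, hence is orthogonal to its derivative.\<close>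

lemma normal_profile_orthogonal:
  assumes "u \<in> S"
  shows "h' u / \<rho> u * deriv (\<lambda>u. h' u / \<rho> u) u + g' u / \<rho> u * deriv (\<lambda>u. g' u / \<rho> u) u = 0"
proof -
  let ?a = "\<lambda>u. h' u / \<rho> u" and ?b = "\<lambda>u. g' u / \<rho> u"
  have "((\<lambda>u. (?a u)\<^sup>2 + (?b u)\<^sup>2) has_real_derivative
      2 * (?a u * deriv ?a u + ?b u * deriv ?b u)) (at u)"
    by (rule DERIV_cong[OF DERIV_add[OF deriv_normal_profile[OF assms, THEN DERIV_power[where n = 2]]]])
      (simp add: algebra_simps)
  moreover have "((\<lambda>u. (?a u)\<^sup>2 + (?b u)\<^sup>2) has_real_derivative 0) (at u)"
  proof (rule has_field_derivative_transform_within_open[OF DERIV_const open_S assms])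
    show "1 = (?a x)\<^sup>2 + (?b x)\<^sup>2" if "x \<in> S" for x
    proof -
      have "(?a x)\<^sup>2 + (?b x)\<^sup>2 = ((g' x)\<^sup>2 + (h' x)\<^sup>2) / (\<rho> x)\<^sup>2"
        by (simp add: power_divide add_divide_distrib)
      then show ?thesis
        using \<rho>_pos[OF that] by (simp add: speed[OF that])
    qed
  qed
  ultimately have "2 * (?a u * deriv ?a u + ?b u * deriv ?b u) = 0"
    by (rule DERIV_unique)
  then show ?thesis by simp
qed

lemma has_derivative_normal:
  assumes "u \<in> S"
  shows "(normal has_derivative (\<lambda>(x, y). vector
     [- deriv (\<lambda>u. h' u / \<rho> u) u * x * cos (c * v) - c * - (h' u / \<rho> u) * y * sin (c * v),
      - deriv (\<lambda>u. h' u / \<rho> u) u * x * sin (c * v) + c * - (h' u / \<rho> u) * y * cos (c * v),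
      deriv (\<lambda>u. g' u / \<rho> u) u * x])) (at (u, v))"
  by (intro has_derivative_revolve DERIV_minus deriv_normal_profile assms)

text \<open>Injectivity of \<open>df\<close> makes any solution \<open>y\<close> of \<open>df y = - dN x\<close> the value of the shape operator,
  and \<open>N\<close> may be replaced by the explicit normal because the two agree on an open set.\<close>

lemma shape_operator_f_eqI:
  assumes "u \<in> S"
    and "frechet_derivative f (at (u, v)) y = - frechet_derivative normal (at (u, v)) x"
  shows "shape_operator f (u, v) x = y"
proof -
  have "open (S \<times> (UNIV :: real set))"
    using open_S by (simp add: open_Times)
  moreover have "normal differentiable at (u, v)"
    using has_derivative_normal[OF assms(1)] differentiable_def by blast
  ultimately have N: "frechet_derivative (unit_normal f) (at (u, v)) = frechet_derivative normal (at (u, v))"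
    using assms(1) unit_normal_f
    by (intro frechet_derivative_transform_within_open[symmetric]) auto
  show ?thesis
    unfolding shape_operator_def N
  proof (rule the_equality)
    show "frechet_derivative f (at (u, v)) y = - frechet_derivative normal (at (u, v)) x"
      by (rule assms(2))
  next
    fix z assume "frechet_derivative f (at (u, v)) z = - frechet_derivative normal (at (u, v)) x"
    then show "z = y"
      using assms(2) by (intro injD[OF inj_frechet_derivative_f[OF assms(1), of v]]) simp
  qed
qed

text \<open>Write \<open>a = h' / \<rho>\<close> and \<open>b = g' / \<rho>\<close>. In the plane of the profile, \<open>(b, a)\<close> is the unit tangent and
  \<open>- dN (1, 0)\<close> has components \<open>(a', -b')\<close>. The latter is a multiple of \<open>(b, a)\<close> by orthogonality, and
  the inner product \<open>a' b - b' a\<close> is the factor; it is the signed curvature of the profile up to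
  the speed \<open>\<rho>\<close>. The second eigenvalue \<open>c a / \<rho>\<close> is \<open>a / g\<close>, the normal curvature of the circle of
  radius \<open>g\<close>.\<close>

lemma shape_operator_f:
  assumes "u \<in> S"
  shows "\<exists>l1 l2. \<forall>v. shape_operator f (u, v) (1, 0) = (l1, 0)
    \<and> shape_operator f (u, v) (0, 1) = (0, l2)"
proof -
  define a b where "a = h' u / \<rho> u" and "b = g' u / \<rho> u"
  define a' b' where "a' = deriv (\<lambda>u. h' u / \<rho> u) u" and "b' = deriv (\<lambda>u. g' u / \<rho> u) u"
  have \<rho>: "\<rho> u > 0" by (rule \<rho>_pos[OF assms])
  have h': "h' u = \<rho> u * a" and g': "g' u = \<rho> u * b"
    using \<rho> by (simp_all add: a_def b_def)
  have "(\<rho> u)\<^sup>2 * (a\<^sup>2 + b\<^sup>2) = (\<rho> u)\<^sup>2 * 1"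
    using speed[OF assms] by (simp add: h' g' power_mult_distrib algebra_simps)
  then have unit: "a\<^sup>2 + b\<^sup>2 = 1"
    using \<rho> by (simp only: mult_cancel_left) simp
  have orth: "a * a' + b * b' = 0"
    using normal_profile_orthogonal[OF assms] by (simp add: a_def b_def a'_def b'_def)
  have a': "(a' * b - b' * a) * b = a'" and b': "(a' * b - b' * a) * a = - b'"
    using unit orth by algebra+
  have N: "frechet_derivative normal (at (u, v)) (x, y) = vector
     [- a' * x * cos (c * v) - c * - a * y * sin (c * v),
      - a' * x * sin (c * v) + c * - a * y * cos (c * v), b' * x]" for v x y
    using frechet_derivative_at[OF has_derivative_normal[OF assms], symmetric]
    by (simp add: a_def a'_def b'_def)
  have "shape_operator f (u, v) (1, 0) = ((a' * b - b' * a) / \<rho> u, 0)" for v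
  proof (rule shape_operator_f_eqI[OF assms])
    have "g' u * ((a' * b - b' * a) / \<rho> u) = a'" "h' u * ((a' * b - b' * a) / \<rho> u) = - b'"
      using \<rho> a' b' by (simp_all add: g' h' mult.commute)
    then show "frechet_derivative f (at (u, v)) ((a' * b - b' * a) / \<rho> u, 0)
        = - frechet_derivative normal (at (u, v)) (1, 0)"
      unfolding N frechet_derivative_f[OF assms] by (simp add: vec_eq_iff forall_3)
  qed
  moreover have "shape_operator f (u, v) (0, 1) = (0, c * a / \<rho> u)" for v
  proof (rule shape_operator_f_eqI[OF assms])
    show "frechet_derivative f (at (u, v)) (0, c * a / \<rho> u)
        = - frechet_derivative normal (at (u, v)) (0, 1)"
      unfolding N frechet_derivative_f[OF assms] using \<rho> by (simp add: vec_eq_iff forall_3)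
  qed
  ultimately show ?thesis by blast
qed

lemma twist_zero_f: "S = einterval u1 u2 \<Longrightarrow> twist_zero u1 u2 f"
  using shape_operator_f unfolding twist_zero_def by metis

end

section \<open>Existence of the profile curve\<close>

theorem theorem1p6:
  fixes u1 u2 :: ereal and \<rho> :: "real \<Rightarrow> real" and c :: real
  assumes "u1 < u2"
    and "\<And>u. u \<in> einterval u1 u2 \<Longrightarrow> \<rho> u > 0"
    and "C_k_on 3 \<rho> (einterval u1 u2)"
    and "c > 0"
    and "\<And>u. u \<in> einterval u1 u2 \<Longrightarrow> c * \<rho> u > \<bar>deriv \<rho> u\<bar>"
  shows "\<exists>f :: real \<times> real \<Rightarrow> real^3.
           intrinsic_surface_of_revolution u1 u2 \<rho> f \<and> twist_zero u1 u2 f \<and>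
           (\<exists>g h :: real \<Rightarrow> real. \<forall>u\<in>einterval u1 u2. \<forall>v.
              f (u, v) = vector [g u * cos (c * v), g u * sin (c * v), h u])"
proof -
  let ?S = "einterval u1 u2"
  note S = open_einterval[of u1 u2]
  define g g' where "g = (\<lambda>u. 1 / c * \<rho> u)" and "g' = (\<lambda>u. 1 / c * deriv \<rho> u)"
  define h' where "h' = (\<lambda>u. sqrt (\<rho> u * \<rho> u + (-1) * (g' u * g' u)))"
  have \<rho>3: "C_k_on (Suc 2) \<rho> ?S"
    using assms(3) by (simp only: eval_nat_numeral)
  have \<rho>2: "C_k_on 2 \<rho> ?S"
    by (rule C_k_on_SucD[OF \<rho>3])
  have \<rho>': "\<forall>u\<in>?S. \<rho> differentiable at u" "C_k_on 2 (deriv \<rho>) ?S"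
    using \<rho>3 unfolding C_k_on_Suc_real_iff[OF S] by blast+
  have g3: "C_k_on 3 g ?S"
    unfolding g_def by (intro C_k_on_mult C_k_on_const S assms(3))
  have g'2: "C_k_on 2 g' ?S"
    unfolding g'_def by (intro C_k_on_mult C_k_on_const S \<rho>')
  \<comment> \<open>Strict positivity keeps the radicand away from \<open>0\<close>, where the square root is not smooth.\<close>
  have slope: "\<rho> u * \<rho> u + (-1) * (g' u * g' u) > 0" if "u \<in> ?S" for u
  proof -
    have "\<bar>g' u\<bar> < \<rho> u"
      using assms(4) assms(5)[OF that] by (simp add: g'_def abs_mult field_simps)
    then have "(g' u)\<^sup>2 < (\<rho> u)\<^sup>2"
      by (metis abs_ge_zero power2_abs power_strict_mono pos2)
    then show ?thesis by (simp add: power2_eq_square)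
  qed
  have h'2: "C_k_on 2 h' ?S"
    unfolding h'_def
    by (intro C_k_on_sqrt C_k_on_add C_k_on_mult C_k_on_const S \<rho>2 g'2 slope)
  have diff: "\<forall>u\<in>?S. g' differentiable at u" "\<forall>u\<in>?S. h' differentiable at u"
    using g'2 h'2 unfolding numeral_2_eq_2 C_k_on_Suc_real_iff[OF S] by blast+
  obtain h where h: "\<And>u. u \<in> ?S \<Longrightarrow> (h has_real_derivative h' u) (at u)"
  proof -
    have "isCont h' u" if "u1 < ereal u" "ereal u < u2" for u
      using diff(2) that differentiable_imp_continuous_within by (auto simp: einterval_def)
    from einterval_antiderivative[OF assms(1) this] show ?thesis
      using that by (auto simp: einterval_def has_real_derivative_iff_has_vector_derivative)
  qed
  have h3: "C_k_on 3 h ?S"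
    using C_k_on_Suc_realI[OF S h h'2] by (simp only: eval_nat_numeral)
  interpret conformal_profile ?S c \<rho> g h g' h'
  proof
    show "(g has_real_derivative g' u) (at u)" if "u \<in> ?S" for u
      unfolding g_def g'_def using that \<rho>'(1)
      by (intro DERIV_cmult) (simp add: DERIV_deriv_iff_real_differentiable)
    show "(g' u)\<^sup>2 + (h' u)\<^sup>2 = (\<rho> u)\<^sup>2" if "u \<in> ?S" for u
      using slope[OF that] by (simp add: h'_def power2_eq_square)
  qed (use assms(2,4) diff h in \<open>auto simp: g_def\<close>)
  have "intrinsic_surface_of_revolution u1 u2 \<rho> f"
    unfolding intrinsic_surface_of_revolution_def immersed_surface_def strip_def
    using C_k_on_revolve[OF S g3 h3] inj_frechet_derivative_f first_fundamental_form_f assms(2)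
    by blast
  moreover have "f (u, v) = vector [g u * cos (c * v), g u * sin (c * v), h u]" for u v
    by (simp add: revolve_def)
  ultimately show ?thesis
    using twist_zero_f by blast
qed

end
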